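(* Let $m\ge1$ be an integer and $n=2m-2$. Let $y_1,\ldots,y_m$ be distinct rationals. The following are equivalent: (i) there exist $x_1,\ldots,x_m\in\mathbb{Q}$ such that $\sum_{i=1}^mx_iy_i^k=a_k$ for all $k=0,1,\ldots,n$; (ii) there exists $c\in\mathbb{Q}$ such that $y_1,\ldots,y_m$ are the zeros of the quasi-Hermite polynomial $H_{m;c}(x)=H_m(x)+c\,H_{m-1}(x)$.
   Context: Here $a_k=\frac{1}{\sqrt{\pi}}\int_{-\infty}^{\infty}t^ke^{-t^2}\,dt$ for $k\ge 0$, i.e. $a_{2k}=\frac{(2k)!}{2^{2k}k!}$ and $a_{2k+1}=0$; convention $y^0=1$. $H_n$ is the $n$-th (physicists') Hermite polynomial, $H_n(x)=(-1)^ne^{x^2}\frac{d^n}{dx^n}e^{-x^2}=\sum_{k=0}^{\lfloor n/2\rfloor}(-1)^k\frac{n!}{k!(n-2k)!}(2x)^{n-2k}$. *)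

theory Defs
  imports "HOL-Computational_Algebra.Computational_Algebra" "HOL-Probability.Probability"
begin

definition gauss_moment :: "nat \<Rightarrow> real" where
  "gauss_moment k = 1 / sqrt pi * (LINT t|lborel. t ^ k * exp (- t\<^sup>2))"

text \<open>The physicists' Hermite polynomials, with leading coefficient \<open>2 ^ n\<close>; the equivalence
  with the Rodrigues formula is \<open>hermite_Rodrigues\<close> below.\<close>

definition hermite :: "nat \<Rightarrow> real poly" where
  "hermite n =
     (\<Sum>k\<le>n div 2. smult ((- 1) ^ k * (fact n / (fact k * fact (n - 2 * k))))
                        ([:0, 2:] ^ (n - 2 * k)))"

definition quasi_hermite :: "nat \<Rightarrow> real \<Rightarrow> real poly" where
  "quasi_hermite m c = hermite m + smult c (hermite (m - 1))"

lemma coeff_hermite: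
  "coeff (hermite n) j =
     (if j \<le> n \<and> even (n - j)
      then (- 1) ^ ((n - j) div 2) * (fact n / (fact ((n - j) div 2) * fact j)) * 2 ^ j else 0)"
proof -
  have pw: "coeff ([:0, 2:] ^ i) j = (if j = i then 2 ^ i else (0::real))" for i
  proof -
    have "[:0, 2:] = smult 2 (monom (1::real) 1)" by (simp add: monom_altdef)
    then have "[:0, 2:] ^ i = smult (2 ^ i) (monom (1::real) i)"
      by (simp add: smult_power monom_power)
    then show ?thesis by (simp add: coeff_monom)
  qed
  let ?f = "\<lambda>k. (- 1) ^ k * (fact n / (fact k * fact (n - 2 * k))) * (2::real) ^ (n - 2 * k)"
  have "coeff (hermite n) j = (\<Sum>k\<le>n div 2. if j = n - 2 * k then ?f k else 0)"
    unfolding hermite_def coeff_sum coeff_smult pw by (intro sum.cong) auto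
  also have "\<dots> = (\<Sum>k\<le>n div 2. if k = (n - j) div 2 then
        (if j \<le> n \<and> even (n - j) then ?f ((n - j) div 2) else 0) else 0)"
  proof (intro sum.cong refl)
    fix k assume "k \<in> {..n div 2}"
    then have k: "2 * k \<le> n" by auto
    show "(if j = n - 2 * k then ?f k else 0) = (if k = (n - j) div 2 then
        (if j \<le> n \<and> even (n - j) then ?f ((n - j) div 2) else 0) else 0)"
    proof (cases "j = n - 2 * k")
      case True
      with k have "n - j = 2 * k" "j \<le> n" by auto
      then show ?thesis using True by simp
    next
      case False
      then have "\<not> (k = (n - j) div 2 \<and> j \<le> n \<and> even (n - j))" using k by presburger
      then show ?thesis using False by auto
    qed
  qed
  also have "\<dots> = (if j \<le> n \<and> even (n - j) then ?f ((n - j) div 2) else 0)"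
    by (simp add: div_le_mono)
  also have "\<dots> = (if j \<le> n \<and> even (n - j)
      then (- 1) ^ ((n - j) div 2) * (fact n / (fact ((n - j) div 2) * fact j)) * 2 ^ j else 0)"
    by (auto elim!: evenE)
  finally show ?thesis .
qed

lemma hermite_Suc: "hermite (Suc n) = [:0, 2:] * hermite n - pderiv (hermite n)"
proof (rule poly_eqI)
  fix j
  show "coeff (hermite (Suc n)) j = coeff ([:0, 2:] * hermite n - pderiv (hermite n)) j"
  proof (cases "j \<le> Suc n \<and> even (Suc n - j)")
    case False
    then show ?thesis
      by (cases j) (auto simp: coeff_pderiv coeff_hermite)
  next
    case True
    then obtain k where k: "Suc n - j = 2 * k" by blast
    with True have n: "Suc n = j + 2 * k" by simp
    show ?thesis
    proof (cases k)
      case 0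
      then have j: "j = Suc n" using n by simp
      show ?thesis unfolding j
        by (simp add: coeff_pderiv coeff_hermite del: fact_Suc)
    next
      case (Suc l)
      then have n': "n = Suc (j + 2 * l)" using n by simp
      have h1: "coeff (hermite n) (Suc j) = (- 1) ^ l * (fact n / (fact l * fact (Suc j))) * 2 ^ Suc j"
        unfolding coeff_hermite by (simp add: n')
      have h2: "coeff (hermite (Suc n)) j = (- 1) ^ Suc l * (fact (Suc n) / (fact (Suc l) * fact j)) * 2 ^ j"
        unfolding coeff_hermite by (simp add: n' del: fact_Suc)
      have h3: "coeff ([:0, 2:] * hermite n) j = (if j = 0 then 0 else
          2 * ((- 1) ^ Suc l * (fact n / (fact (Suc l) * fact (j - 1))) * 2 ^ (j - 1)))"
        by (cases j) (simp_all add: coeff_hermite n' del: fact_Suc)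
      have nr: "real (Suc n) = real j + 2 * real (Suc l)" by (simp add: n')
      have fS: "(fact (Suc n) :: real) = (real j + 2 * real (Suc l)) * fact n"
        by (simp only: nr fact_Suc)
      show ?thesis
        unfolding coeff_diff coeff_pderiv h1 h2 h3 fS
        by (cases j) (simp_all add: divide_simps del: of_nat_Suc, simp_all add: algebra_simps)
    qed
  qed
qed

lemma hermite_Rodrigues:
  "poly (hermite n) x = (- 1) ^ n * exp (x\<^sup>2) * (deriv ^^ n) (\<lambda>x. exp (- x\<^sup>2)) x"
proof -
  have "(deriv ^^ n) (\<lambda>x. exp (- x\<^sup>2)) = (\<lambda>x. (- 1) ^ n * (poly (hermite n) x * exp (- x\<^sup>2)))"
  proof (induction n)
    case 0
    then show ?case by (simp add: hermite_def)
  next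
    case (Suc n)
    have "((\<lambda>x. (- 1) ^ n * (poly (hermite n) x * exp (- x\<^sup>2))) has_real_derivative
        (- 1) ^ Suc n * (poly (hermite (Suc n)) x * exp (- x\<^sup>2))) (at x)" for x
      by (auto intro!: derivative_eq_intros poly_DERIV simp: hermite_Suc algebra_simps)
    then show ?case by (auto simp: Suc intro!: ext DERIV_imp_deriv)
  qed
  then show ?thesis by (simp flip: exp_add add: mult_ac power_mult_distrib[symmetric])
qed

lemma gauss_moment_even: "gauss_moment (2 * k) = fact (2 * k) / (2 ^ (2 * k) * fact k)"
proof -
  have "has_bochner_integral lborel (\<lambda>x::real. exp (- x\<^sup>2) * x ^ (2 * k))
      (sqrt pi * (fact (2 * k) / (2 ^ (2 * k) * fact k)))"
    using has_bochner_integral_even_function[OF gaussian_moment_even_pos[of k]] by simp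
  then show ?thesis
    by (simp add: gauss_moment_def has_bochner_integral_integral_eq mult.commute)
qed

lemma gauss_moment_odd: "gauss_moment (2 * k + 1) = 0"
  using has_bochner_integral_odd_function[OF gaussian_moment_odd_pos[of k]]
  by (simp add: gauss_moment_def has_bochner_integral_integral_eq mult.commute)

end

theory Submission
  imports Defs
begin

text \<open>
  Let \<open>L\<close> be the linear functional on polynomials that sends \<open>X ^ k\<close> to the \<open>k\<close>-th Gaussian
  moment. Integration by parts gives \<open>L (2 X p) = L (p')\<close>; with the recurrence
  \<open>H\<^sub>n\<^sub>+\<^sub>1 = 2 X H\<^sub>n - H\<^sub>n'\<close> this turns into \<open>L (H\<^sub>n p) = L (p\<^sup>(\<^sup>n\<^sup>))\<close>, so that \<open>L (H\<^sub>n p)\<close> is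
  \<open>n!\<close> times the coefficient of \<open>X ^ n\<close> in \<open>p\<close> whenever \<open>p\<close> has degree at most \<open>n\<close>
  (\<open>gauss_functional_hermite\<close>). This one formula holds both the orthogonality of the Hermite
  polynomials and their norms.

  Condition (i) says that \<open>L\<close> agrees in degrees up to \<open>2 m - 2\<close> with the quadrature
  rule \<open>p \<mapsto> \<Sum> x\<^sub>i p (y\<^sub>i)\<close>, and the theorem is an instance of the classical link between such
  rules and orthogonal polynomials.

  If there is such a rule, the polynomial \<open>P\<close> of degree \<open>m\<close> with roots \<open>y\<^sub>i\<close> satisfies
  \<open>L (P q) = 0\<close> for all \<open>q\<close> of degree below \<open>m - 1\<close>, since the rule vanishes on \<open>P q\<close>.
  When \<open>P\<close> has leading coefficient \<open>2 ^ m\<close>, this forces \<open>P = H\<^sub>m + c H\<^sub>m\<^sub>-\<^sub>1\<close>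
  (\<open>quasi_hermite_if_orthogonal\<close>), and \<open>c\<close> is rational because it can be read off from a
  coefficient of \<open>P\<close>.

  Conversely, let \<open>P = H\<^sub>m + c H\<^sub>m\<^sub>-\<^sub>1\<close> vanish at the nodes. The weights are the values of \<open>L\<close> on the
  Lagrange basis polynomials, which are rational. The resulting rule is exact in degrees
  below \<open>m\<close> by interpolation, and division with remainder by \<open>P\<close> extends this to degree
  \<open>2 m - 2\<close> because \<open>L\<close> vanishes on the multiples of \<open>P\<close> that occur.
\<close>

section \<open>The Gaussian moment functional\<close>

definition gauss_functional :: "real poly \<Rightarrow> real" where
  "gauss_functional p = (\<Sum>k\<le>degree p. coeff p k * gauss_moment k)"

lemma gauss_functional_altdef:
  assumes "degree p \<le> N"
  shows "gauss_functional p = (\<Sum>k\<le>N. coeff p k * gauss_moment k)"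
  unfolding gauss_functional_def
  by (rule sum.mono_neutral_left) (use assms in \<open>auto simp: coeff_eq_0\<close>)

lemma gauss_functional_add: "gauss_functional (p + q) = gauss_functional p + gauss_functional q"
proof -
  let ?N = "max (degree p) (degree q)"
  have "degree (p + q) \<le> ?N" by (rule degree_add_le_max)
  then show ?thesis
    by (simp add: gauss_functional_altdef[of _ ?N] sum.distrib algebra_simps)
qed

lemma gauss_functional_smult: "gauss_functional (smult c p) = c * gauss_functional p"
  by (simp add: gauss_functional_altdef[of _ "degree p"] sum_distrib_left mult.assoc)

lemma gauss_functional_0: "gauss_functional 0 = 0"
  by (simp add: gauss_functional_def)

lemma gauss_functional_diff: "gauss_functional (p - q) = gauss_functional p - gauss_functional q"
  using gauss_functional_add[of "p - q" q] by simp

lemma gauss_functional_sum: "gauss_functional (\<Sum>i\<in>A. f i) = (\<Sum>i\<in>A. gauss_functional (f i))"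
  by (induction A rule: infinite_finite_induct)
     (simp_all add: gauss_functional_0 gauss_functional_add)

lemma gauss_functional_monom: "gauss_functional (monom c k) = c * gauss_moment k"
proof -
  have "gauss_functional (monom c k) = (\<Sum>j\<le>k. coeff (monom c k) j * gauss_moment j)"
    by (rule gauss_functional_altdef) (rule degree_monom_le)
  also have "\<dots> = (\<Sum>j\<le>k. if j = k then c * gauss_moment j else 0)"
    by (intro sum.cong) auto
  finally show ?thesis by simp
qed

lemma gauss_moment_0: "gauss_moment 0 = 1"
  using gauss_moment_even[of 0] by simp

lemma gauss_moment_Suc: "2 * gauss_moment (Suc k) = real k * gauss_moment (k - 1)"
proof (cases "even k")
  case True
  then obtain j where "k = 2 * j" by blast
  then show ?thesis
    using gauss_moment_odd[of j] gauss_moment_odd[of "j - 1"] by (cases j) auto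
next
  case False
  then obtain j where k: "k = 2 * j + 1" by (blast elim: oddE)
  have "gauss_moment (2 * Suc j) = fact (2 * Suc j) / (2 ^ (2 * Suc j) * fact (Suc j))"
    by (rule gauss_moment_even)
  moreover have "fact (2 * Suc j) = (2 * real j + 2) * (2 * real j + 1) * fact (2 * j)"
    by (simp add: algebra_simps)
  ultimately have "gauss_moment (2 * Suc j) =
      ((2 * real j + 2) * (2 * real j + 1) * fact (2 * j)) / (4 * 2 ^ (2 * j) * ((real j + 1) * fact j))"
    by (simp add: algebra_simps)
  also have "\<dots> = (2 * real j + 1) / 2 * (fact (2 * j) / (2 ^ (2 * j) * fact j))"
    by (simp add: divide_simps)
  finally show ?thesis
    by (simp add: k gauss_moment_even)
qed

lemma gauss_moment_Rats: "gauss_moment k \<in> \<rat>"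
proof (cases "even k")
  case True
  then obtain j where "k = 2 * j" by blast
  moreover have "fact i \<in> (\<rat> :: real set)" for i
    by (metis Rats_of_nat of_nat_fact)
  ultimately show ?thesis
    by (simp add: gauss_moment_even)
next
  case False
  then obtain j where "k = 2 * j + 1" by (blast elim: oddE)
  then show ?thesis using gauss_moment_odd[of j] by simp
qed

text \<open>In terms of integrals this is integration by parts against the weight \<open>exp (- t\<^sup>2)\<close>, whose
  derivative is \<open>- 2 t exp (- t\<^sup>2)\<close>.\<close>

lemma gauss_functional_by_parts:
  "gauss_functional ([:0, 2:] * p) = gauss_functional (pderiv p)"
proof -
  let ?N = "degree p"
  have "gauss_functional ([:0, 2:] * p) = 2 * gauss_functional (pCons 0 p)"
    by (simp flip: gauss_functional_smult)
  also have "gauss_functional (pCons 0 p) = (\<Sum>k\<le>Suc ?N. coeff (pCons 0 p) k * gauss_moment k)"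
    by (rule gauss_functional_altdef) (simp add: degree_pCons_le)
  also have "\<dots> = (\<Sum>k\<le>?N. coeff p k * gauss_moment (Suc k))"
    by (simp only: sum.atMost_Suc_shift) simp
  also have "2 * \<dots> = (\<Sum>k\<le>?N. coeff p k * (2 * gauss_moment (Suc k)))"
    by (simp add: sum_distrib_left mult_ac)
  also have "\<dots> = (\<Sum>k\<le>?N. real k * coeff p k * gauss_moment (k - 1))"
    by (simp only: gauss_moment_Suc) (simp add: mult_ac)
  also have "\<dots> = (\<Sum>k\<le>Suc ?N. real k * coeff p k * gauss_moment (k - 1))"
    by (simp add: coeff_eq_0)
  also have "\<dots> = (\<Sum>k\<le>?N. coeff (pderiv p) k * gauss_moment k)"
    by (simp only: sum.atMost_Suc_shift) (simp add: coeff_pderiv)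
  also have "\<dots> = gauss_functional (pderiv p)"
    by (rule gauss_functional_altdef[symmetric]) (simp add: degree_pderiv)
  finally show ?thesis .
qed

section \<open>Orthogonality of the Hermite polynomials\<close>

lemma gauss_functional_hermite_higher_pderiv:
  "gauss_functional (hermite n * p) = gauss_functional ((pderiv ^^ n) p)"
proof (induction n arbitrary: p)
  case 0
  then show ?case by (simp add: hermite_def)
next
  case (Suc n)
  have "hermite (Suc n) * p = [:0, 2:] * (hermite n * p) - pderiv (hermite n) * p"
    by (simp add: hermite_Suc algebra_simps)
  then have "gauss_functional (hermite (Suc n) * p) =
      gauss_functional (pderiv (hermite n * p)) - gauss_functional (pderiv (hermite n) * p)"
    by (simp only: gauss_functional_diff gauss_functional_by_parts)
  also have "\<dots> = gauss_functional (hermite n * pderiv p)"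
    by (simp add: pderiv_mult gauss_functional_add mult.commute)
  also have "\<dots> = gauss_functional ((pderiv ^^ Suc n) p)"
    by (simp only: Suc.IH funpow_Suc_right o_def)
  finally show ?case .
qed

text \<open>The \<open>n\<close>-th derivative of such a \<open>p\<close> is a constant, and the functional is the identity on
  constants.\<close>

lemma gauss_functional_hermite:
  assumes "degree p \<le> n"
  shows "gauss_functional (hermite n * p) = fact n * coeff p n"
proof -
  have "degree ((pderiv ^^ n) p) = 0"
    using assms by (simp add: degree_higher_pderiv)
  then have "gauss_functional ((pderiv ^^ n) p) = fact n * coeff p n"
    by (simp add: gauss_functional_def coeff_higher_pderiv pochhammer_fact gauss_moment_0)
  then show ?thesis
    by (simp only: gauss_functional_hermite_higher_pderiv)
qed

lemma degree_hermite_le: "degree (hermite n) \<le> n"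
  by (rule degree_le) (simp add: coeff_hermite)

lemma coeff_hermite_self: "coeff (hermite n) n = 2 ^ n"
  by (simp add: coeff_hermite)

lemma coeff_quasi_hermite_self:
  assumes "m \<ge> 1"
  shows "coeff (quasi_hermite m c) m = 2 ^ m"
  using assms by (simp add: quasi_hermite_def coeff_hermite)

lemma degree_quasi_hermite:
  assumes "m \<ge> 1"
  shows "degree (quasi_hermite m c) = m"
proof (rule antisym)
  show "degree (quasi_hermite m c) \<le> m"
    using degree_hermite_le[of m] degree_hermite_le[of "m - 1"] unfolding quasi_hermite_def
    by (intro degree_add_le order.trans[OF degree_smult_le]) auto
  show "m \<le> degree (quasi_hermite m c)"
    by (rule le_degree) (simp add: coeff_quasi_hermite_self[OF assms])
qed

text \<open>The two conditions on \<open>q\<close>, here and in the converse, express that \<open>q\<close> is zero or of degree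
  below \<open>m - 1\<close>; in this form they cover \<open>m = 1\<close>, where only \<open>q = 0\<close> qualifies although
  \<open>degree 0 < m - 1\<close> fails.\<close>

lemma gauss_functional_quasi_hermite:
  assumes "m \<ge> 1" "degree q \<le> m - 1" "coeff q (m - 1) = 0"
  shows "gauss_functional (quasi_hermite m c * q) = 0"
proof -
  have "gauss_functional (hermite m * q) = 0"
    using assms by (subst gauss_functional_hermite) (auto simp: coeff_eq_0)
  moreover have "gauss_functional (hermite (m - 1) * q) = 0"
    using assms by (simp add: gauss_functional_hermite)
  ultimately show ?thesis
    by (simp add: quasi_hermite_def algebra_simps gauss_functional_add gauss_functional_smult)
qed

text \<open>The difference \<open>R\<close> of the two sides again satisfies the orthogonality relations. The leading
  coefficient of \<open>P\<close> and the choice of \<open>c\<close> cancel its two top terms, so if \<open>R\<close> were nonzero, its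
  degree \<open>d\<close> would be below \<open>m - 1\<close>. Then \<open>H\<^sub>d\<close> would be an admissible test polynomial, but testing with it returns \<open>d!\<close> times
  the leading coefficient of \<open>R\<close>.\<close>

lemma quasi_hermite_if_orthogonal:
  assumes m: "m \<ge> 1" and deg: "degree P \<le> m" and lead: "coeff P m = 2 ^ m"
    and orth: "\<And>q. degree q \<le> m - 1 \<Longrightarrow> coeff q (m - 1) = 0 \<Longrightarrow> gauss_functional (P * q) = 0"
  shows "P = quasi_hermite m (coeff P (m - 1) / 2 ^ (m - 1))"
proof -
  define c where "c = coeff P (m - 1) / 2 ^ (m - 1)"
  define R where "R = P - quasi_hermite m c"
  have R_m: "coeff R m = 0"
    by (simp add: R_def lead coeff_quasi_hermite_self[OF m])
  have R_m1: "coeff R (m - 1) = 0"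
  proof -
    have "coeff (hermite m) (m - 1) = 0" using m by (simp add: coeff_hermite)
    then show ?thesis by (simp add: R_def quasi_hermite_def c_def coeff_hermite_self)
  qed
  have R_orth: "gauss_functional (R * q) = 0" if "degree q \<le> m - 1" "coeff q (m - 1) = 0" for q
    using orth[OF that] gauss_functional_quasi_hermite[OF m that]
    by (simp add: R_def left_diff_distrib gauss_functional_diff)
  have "R = 0"
  proof (rule ccontr)
    assume "R \<noteq> 0"
    then have nz: "coeff R (degree R) \<noteq> 0" by simp
    have "degree R \<le> m"
      unfolding R_def using deg degree_quasi_hermite[OF m] by (intro degree_diff_le) auto
    moreover have "degree R \<noteq> m" "degree R \<noteq> m - 1" using nz R_m R_m1 by metis+
    ultimately have d: "degree R < m - 1" by linarith
    have "gauss_functional (R * hermite (degree R)) = 0"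
    proof (rule R_orth)
      show "degree (hermite (degree R)) \<le> m - 1"
        using degree_hermite_le[of "degree R"] d by linarith
      show "coeff (hermite (degree R)) (m - 1) = 0"
        using d by (simp add: coeff_hermite)
    qed
    moreover have "gauss_functional (hermite (degree R) * R) = fact (degree R) * coeff R (degree R)"
      by (rule gauss_functional_hermite) simp
    ultimately show False using nz by (simp add: mult.commute)
  qed
  then show ?thesis by (simp add: R_def c_def)
qed

section \<open>Polynomials with rational coefficients\<close>

lemma coeff_mult_Rats:
  fixes p q :: "'a :: field_char_0 poly"
  assumes "\<And>k. coeff p k \<in> \<rat>" "\<And>k. coeff q k \<in> \<rat>"
  shows "coeff (p * q) k \<in> \<rat>"
  unfolding coeff_mult using assms by (intro Rats_sum Rats_mult) auto

lemma coeff_prod_Rats: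
  fixes f :: "'b \<Rightarrow> 'a :: field_char_0 poly"
  assumes "\<And>i k. i \<in> A \<Longrightarrow> coeff (f i) k \<in> \<rat>"
  shows "coeff (\<Prod>i\<in>A. f i) k \<in> \<rat>"
  using assms
proof (induction A arbitrary: k rule: infinite_finite_induct)
  case (insert a A)
  then show ?case by (auto intro!: coeff_mult_Rats)
qed (auto simp: coeff_1)

lemma coeff_linear_Rats:
  fixes a :: "'a :: field_char_0"
  assumes "a \<in> \<rat>"
  shows "coeff [:- a, 1:] k \<in> \<rat>"
  using assms by (auto simp: coeff_pCons split: nat.splits)

lemma gauss_functional_Rats:
  assumes "\<And>k. coeff p k \<in> \<rat>"
  shows "gauss_functional p \<in> \<rat>"
  unfolding gauss_functional_def using assms gauss_moment_Rats
  by (intro Rats_sum Rats_mult) auto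

section \<open>Lagrange interpolation\<close>

definition lagrange_basis :: "'i set \<Rightarrow> ('i \<Rightarrow> 'a) \<Rightarrow> 'i \<Rightarrow> 'a :: field poly" where
  "lagrange_basis I y i =
     smult (inverse (\<Prod>j\<in>I - {i}. y i - y j)) (\<Prod>j\<in>I - {i}. [:- y j, 1:])"

lemma poly_lagrange_basis:
  assumes "finite I" "inj_on y I" "i \<in> I" "j \<in> I"
  shows "poly (lagrange_basis I y i) (y j) = (if i = j then 1 else 0)"
proof (cases "i = j")
  case True
  have "(\<Prod>k\<in>I - {i}. y i - y k) \<noteq> 0"
    using assms by (auto simp: inj_on_def)
  then show ?thesis
    using True by (simp add: lagrange_basis_def poly_prod)
next
  case False
  then have "(\<Prod>k\<in>I - {i}. y j - y k) = 0"
    using assms by (intro prod_zero) auto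
  then show ?thesis
    using False by (simp add: lagrange_basis_def poly_prod)
qed

lemma degree_lagrange_basis_less:
  assumes "finite I" "i \<in> I"
  shows "degree (lagrange_basis I y i) < card I"
proof -
  have "degree (lagrange_basis I y i) \<le> degree (\<Prod>j\<in>I - {i}. [:- y j, 1:])"
    unfolding lagrange_basis_def by (rule degree_smult_le)
  also have "\<dots> \<le> (\<Sum>j\<in>I - {i}. degree [:- y j, 1:])"
    using degree_prod_sum_le[of "I - {i}" "\<lambda>j. [:- y j, 1:]"] assms by (simp add: o_def)
  also have "\<dots> = card I - 1"
    using assms by simp
  also have "\<dots> < card I"
    using assms card_gt_0_iff[of I] by auto
  finally show ?thesis .
qed

lemma lagrange_interpolation:
  fixes y :: "'i \<Rightarrow> 'a :: field"
  assumes "finite I" "inj_on y I" "degree r < card I"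
  shows "r = (\<Sum>i\<in>I. smult (poly r (y i)) (lagrange_basis I y i))" (is "r = ?s")
proof (rule poly_eqI_degree[of "y ` I"])
  fix z assume "z \<in> y ` I"
  then obtain j where j: "j \<in> I" "z = y j" by blast
  have "poly ?s z = (\<Sum>i\<in>I. poly r (y i) * (if i = j then 1 else 0))"
    unfolding poly_sum poly_smult j(2) using assms j(1)
    by (intro sum.cong) (auto simp: poly_lagrange_basis)
  also have "\<dots> = (\<Sum>i\<in>I. if i = j then poly r (y i) else 0)"
    by (intro sum.cong) auto
  finally show "poly r z = poly ?s z"
    using assms(1) j by simp
next
  have card: "card (y ` I) = card I" using assms(2) by (rule card_image)
  show "degree r < card (y ` I)" using assms(3) card by simp
  show "degree ?s < card (y ` I)"
    unfolding card using assms degree_lagrange_basis_less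
    by (intro degree_sum_less le_less_trans[OF degree_smult_le]) auto
qed

lemma coeff_lagrange_basis_Rats:
  fixes y :: "'i \<Rightarrow> 'a :: field_char_0"
  assumes "\<And>j. j \<in> I \<Longrightarrow> y j \<in> \<rat>" "i \<in> I"
  shows "coeff (lagrange_basis I y i) k \<in> \<rat>"
  unfolding lagrange_basis_def coeff_smult using assms
  by (intro Rats_mult Rats_inverse Rats_prod coeff_prod_Rats coeff_linear_Rats Rats_diff) auto

section \<open>Quadrature rules of degree \<open>2 m - 2\<close>\<close>

lemma gauss_functional_eq_quadrature:
  assumes moments: "\<And>k. k \<le> n \<Longrightarrow> (\<Sum>i\<in>I. x i * y i ^ k) = gauss_moment k"
    and "degree p \<le> n"
  shows "gauss_functional p = (\<Sum>i\<in>I. x i * poly p (y i))"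
proof -
  have "gauss_functional p = (\<Sum>k\<le>degree p. \<Sum>i\<in>I. x i * (coeff p k * y i ^ k))"
    unfolding gauss_functional_def using assms
    by (intro sum.cong) (auto simp: sum_distrib_left mult_ac simp flip: moments)
  also have "\<dots> = (\<Sum>i\<in>I. x i * poly p (y i))"
    by (subst sum.swap) (simp add: poly_altdef sum_distrib_left)
  finally show ?thesis .
qed

lemma quadrature_imp_quasi_hermite_roots:
  assumes "finite I" and m: "card I = m" "m \<ge> 1"
    and yRats: "\<And>i. i \<in> I \<Longrightarrow> y i \<in> \<rat>"
    and moments: "\<And>k. k \<le> 2 * m - 2 \<Longrightarrow> (\<Sum>i\<in>I. x i * y i ^ k) = gauss_moment k"
  shows "\<exists>c\<in>\<rat>. {z. poly (quasi_hermite m c) z = 0} = y ` I"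
proof -
  define Q where "Q = (\<Prod>i\<in>I. [:- y i, 1:])"
  \<comment> \<open>The factor gives \<open>P\<close> the leading coefficient of \<open>H\<^sub>m\<close>.\<close>
  define P where "P = smult (2 ^ m) Q"
  have degQ: "degree Q = m"
    unfolding Q_def by (subst degree_prod_eq_sum_degree) (auto simp: m)
  have monic: "lead_coeff Q = 1"
    unfolding Q_def by (simp add: lead_coeff_prod)
  have P_0: "poly P z = 0 \<longleftrightarrow> z \<in> y ` I" for z
    using \<open>finite I\<close> by (auto simp: P_def Q_def poly_prod)
  have PRats: "coeff P k \<in> \<rat>" for k
    unfolding P_def Q_def coeff_smult using yRats
    by (intro Rats_mult coeff_prod_Rats coeff_linear_Rats) auto
  have "P = quasi_hermite m (coeff P (m - 1) / 2 ^ (m - 1))"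
  proof (rule quasi_hermite_if_orthogonal)
    show "m \<ge> 1" by (rule m)
    show "degree P \<le> m" by (simp add: P_def degQ)
    show "coeff P m = 2 ^ m" using monic by (simp add: P_def degQ)
    fix q :: "real poly" assume q: "degree q \<le> m - 1" "coeff q (m - 1) = 0"
    show "gauss_functional (P * q) = 0"
    proof (cases "q = 0")
      case False
      then have "degree q \<noteq> m - 1" using q(2) by (metis leading_coeff_0_iff)
      then have "degree (P * q) \<le> 2 * m - 2"
        using degree_mult_le[of P q] q(1) \<open>m \<ge> 1\<close> by (simp add: P_def degQ)
      then have "gauss_functional (P * q) = (\<Sum>i\<in>I. x i * poly (P * q) (y i))"
        by (intro gauss_functional_eq_quadrature[where n = "2 * m - 2"] moments)
      also have "\<dots> = 0" by (rule sum.neutral) (simp add: P_0)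
      finally show ?thesis .
    qed (simp add: gauss_functional_0)
  qed
  then show ?thesis
    using P_0 PRats by (intro bexI[of _ "coeff P (m - 1) / 2 ^ (m - 1)"]) auto
qed

lemma quasi_hermite_roots_imp_quadrature:
  assumes "finite I" and m: "card I = m" "m \<ge> 1" and inj: "inj_on y I"
    and roots: "\<And>i. i \<in> I \<Longrightarrow> poly (quasi_hermite m c) (y i) = 0"
    and k: "k \<le> 2 * m - 2"
  shows "(\<Sum>i\<in>I. gauss_functional (lagrange_basis I y i) * y i ^ k) = gauss_moment k"
proof -
  define P where "P = quasi_hermite m c"
  define p where "p = monom (1::real) k"
  define q where "q = p div P"
  define r where "r = p mod P"
  have p: "p = P * q + r" by (simp add: q_def r_def)
  have degP: "degree P = m" unfolding P_def by (rule degree_quasi_hermite) (rule m)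
  then have "P \<noteq> 0" using m by auto
  have degr: "degree r < m"
    using degree_mod_less'[of P p] degP \<open>P \<noteq> 0\<close> m unfolding r_def by (metis degree_0 less_le_trans zero_less_one)
  have q: "degree q \<le> m - 1 \<and> coeff q (m - 1) = 0"
  proof (cases "q = 0")
    case False
    have "P * q = p - r" by (simp add: p)
    moreover have "degree (p - r) \<le> 2 * m - 2"
      using k degr m by (intro degree_diff_le) (auto simp: p_def degree_monom_eq)
    ultimately have "m + degree q \<le> 2 * m - 2"
      using False \<open>P \<noteq> 0\<close> degP degree_mult_eq[of P q] by simp
    then have "degree q < m - 1" using m by linarith
    then show ?thesis by (simp add: coeff_eq_0)
  qed simp
  have "gauss_functional (P * q) = 0"
    using q unfolding P_def by (intro gauss_functional_quasi_hermite m) auto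
  then have "gauss_functional p = gauss_functional r"
    by (simp add: p gauss_functional_add)
  also have "\<dots> = (\<Sum>i\<in>I. poly r (y i) * gauss_functional (lagrange_basis I y i))"
    using lagrange_interpolation[OF \<open>finite I\<close> inj, of r] degr
    by (metis (no_types, lifting) gauss_functional_smult gauss_functional_sum m(1) sum.cong)
  also have "\<dots> = (\<Sum>i\<in>I. poly p (y i) * gauss_functional (lagrange_basis I y i))"
    using roots by (intro sum.cong) (auto simp: p P_def)
  finally show ?thesis
    by (simp add: p_def gauss_functional_monom poly_monom mult.commute)
qed

theorem proposition5p4:
  fixes m n :: nat and y :: "nat \<Rightarrow> real"
  assumes "m \<ge> 1" and "n = 2 * m - 2"
    and "\<forall>i\<in>{1..m}. y i \<in> \<rat>" and "inj_on y {1..m}"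
  shows "(\<exists>x :: nat \<Rightarrow> real. (\<forall>i\<in>{1..m}. x i \<in> \<rat>) \<and>
            (\<forall>k\<in>{0..n}. (\<Sum>i=1..m. x i * y i ^ k) = gauss_moment k))
         \<longleftrightarrow> (\<exists>c\<in>\<rat>. {z. poly (quasi_hermite m c) z = 0} = y ` {1..m})"
    (is "?quadrature \<longleftrightarrow> ?roots")
proof
  assume ?quadrature
  then obtain x where "\<And>k. k \<le> 2 * m - 2 \<Longrightarrow> (\<Sum>i=1..m. x i * y i ^ k) = gauss_moment k"
    using assms(2) by (metis atLeastAtMost_iff le0)
  then show ?roots
    using assms by (intro quadrature_imp_quasi_hermite_roots[where x = x]) auto
next
  assume ?roots
  then obtain c where "{z. poly (quasi_hermite m c) z = 0} = y ` {1..m}" by blast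
  then have roots: "poly (quasi_hermite m c) (y i) = 0" if "i \<in> {1..m}" for i
    using that by blast
  let ?x = "\<lambda>i. gauss_functional (lagrange_basis {1..m} y i)"
  have "\<forall>i\<in>{1..m}. ?x i \<in> \<rat>"
    using assms(3) by (intro ballI gauss_functional_Rats coeff_lagrange_basis_Rats) auto
  moreover have "\<forall>k\<in>{0..n}. (\<Sum>i=1..m. ?x i * y i ^ k) = gauss_moment k"
    using assms roots
    by (intro ballI quasi_hermite_roots_imp_quadrature[where m = m and c = c]) auto
  ultimately show ?quadrature
    by (intro exI[of _ ?x] conjI)
qed

end
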